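(* Let $n\ge 1$ be an odd integer. Among the $2^{n+3}$ assignments of over/under data to the crossings of the free $2\ 1\ n$ knot, exactly $$12\binom{n}{\frac{n-1}{2}}+2\binom{n}{\frac{n-3}{2}}$$ produce the unknot.
   Context: Binomial coefficients with negative lower index are $0$. For odd $n$, the free $2\ 1\ n$ knot is the following planar closed curve with $n+3$ double points (the free closure of Conway's $2\ 1\ n$ tangle). Take a horizontal row of $n$ crossings: two parallel horizontal strands crossing each other $n$ times in succession, with four ends (upper-left, lower-left, upper-right, lower-right). Above the row place three further crossings $L$ (left), $R$ (right, at the same height as $L$) and $B$ (centered, below $L$ and $R$), each drawn as an $\mathsf{X}$ with ends NW, NE, SW, SE. Join, without further crossings: NE of $L$ to NW of $R$ by an inner arc; NW of $L$ to NE of $R$ by an outer arc passing above the inner one; SE of $L$ to NW of $B$; SW of $R$ to NE of $B$; SW of $B$ to the upper-left end of the row; SE of $B$ to the upper-right end of the row; SW of $L$ to the lower-left end of the row (around the left side); SE of $R$ to the lower-right end of the row (around the right side). An assignment is a choice, at each crossing, of which of the two strands is the overstrand; it produces a knot diagram. *)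

theory Defs
  imports Main "HOL-Library.FuncSet"
begin

text \<open>
  A planar curve in general position with respect to the height function is described by the list
  of its critical events, read from top to bottom. Between two events the curve consists of
  finitely many vertical strands, numbered from left to right starting with 0.

  \<^item> \<open>Cap i\<close>: a local maximum; the two new strands get the numbers \<open>i\<close> and \<open>i + 1\<close>.
  \<^item> \<open>Cup i\<close>: a local minimum, joining strands \<open>i\<close> and \<open>i + 1\<close>.
  \<^item> \<open>Cross i c\<close>: strands \<open>i\<close> and \<open>i + 1\<close> cross, as in the letter X. The decoration \<open>c\<close> is the name
    of the double point for a curve, and the overstrand for a link diagram.
\<close>

datatype 'c event = Cap nat | Cup nat | Cross nat 'c

fun pos :: "'c event \<Rightarrow> nat" where
  "pos (Cap i) = i"
| "pos (Cup i) = i"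
| "pos (Cross i c) = i"

fun strands_in :: "'c event \<Rightarrow> nat" where
  "strands_in (Cap i) = 0"
| "strands_in (Cup i) = 2"
| "strands_in (Cross i c) = 2"

fun strands_out :: "'c event \<Rightarrow> nat" where
  "strands_out (Cap i) = 2"
| "strands_out (Cup i) = 0"
| "strands_out (Cross i c) = 2"

fun shift :: "nat \<Rightarrow> 'c event \<Rightarrow> 'c event" where
  "shift k (Cap i) = Cap (i + k)"
| "shift k (Cup i) = Cup (i + k)"
| "shift k (Cross i c) = Cross (i + k) c"

text \<open>
  The number of strands at the bottom of a list of events with \<open>w\<close> strands at the top;
  \<open>None\<close> if some event refers to a strand that is not there.
\<close>

fun width :: "nat \<Rightarrow> 'c event list \<Rightarrow> nat option" where
  "width w [] = Some w"
| "width w (e # es) =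
    (if pos e + strands_in e \<le> w then width (w - strands_in e + strands_out e) es else None)"

definition is_closed :: "'c event list \<Rightarrow> bool" where
  "is_closed D \<longleftrightarrow> width 0 D = Some 0"

text \<open>
  The two strands of a crossing, named by their ends: \<open>NW_SE\<close> runs from the upper left to the
  lower right, \<open>NE_SW\<close> from the upper right to the lower left.
\<close>

datatype strand = NW_SE | NE_SW

fun other :: "strand \<Rightarrow> strand" where
  "other NW_SE = NE_SW"
| "other NE_SW = NW_SE"

type_synonym diagram = "strand event list"

text \<open>
  The local moves between link diagrams. The first five rules generate planar isotopy: exchanging
  the heights of two consecutive events of which the second lies to the right of the first,
  straightening a zigzag (two mirror forms), and moving a strand that crosses one leg of an
  extremum to the other leg. The latter turns the picture of the crossing, so that the same
  strand stays on top although its name changes. The remaining rules are the Reidemeister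
  moves; their rotated versions follow using planar isotopy. In \<open>r3\<close> the decorations tell which
  strand is on top for each pair of the three strands; the excluded patterns, \<open>a = c \<noteq> b\<close>, are those
  in which the three strands are cyclically above each other.
\<close>

inductive local_move :: "diagram \<Rightarrow> diagram \<Rightarrow> bool" where
  exchange: "pos e \<le> pos f \<Longrightarrow>
    local_move [e, shift (strands_out e) f] [shift (strands_in e) f, e]"
| zigzag_left: "local_move [Cap i, Cup (i + 1)] []"
| zigzag_right: "local_move [Cap (i + 1), Cup i] []"
| slide_cap: "local_move [Cap i, Cross (i + 1) c] [Cap (i + 1), Cross i (other c)]"
| slide_cup: "local_move [Cross i c, Cup (i + 1)] [Cross (i + 1) (other c), Cup i]"
| r1_cap: "local_move [Cap i, Cross i c] [Cap i]"
| r1_cup: "local_move [Cross i c, Cup i] [Cup i]"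
| r2: "local_move [Cross i c, Cross i (other c)] []"
| r3: "a = b \<or> b = c \<Longrightarrow>
    local_move [Cross i a, Cross (i + 1) b, Cross i c]
               [Cross (i + 1) c, Cross i b, Cross (i + 1) a]"

inductive diagram_move :: "diagram \<Rightarrow> diagram \<Rightarrow> bool" where
  "local_move l r \<Longrightarrow> is_closed (xs @ l @ ys) \<Longrightarrow> is_closed (xs @ r @ ys) \<Longrightarrow>
    diagram_move (xs @ l @ ys) (xs @ r @ ys)"

text \<open>Two link diagrams present the same link iff finitely many moves, in either direction,
  lead from one to the other.\<close>

definition same_link :: "diagram \<Rightarrow> diagram \<Rightarrow> bool" where
  "same_link = equivclp diagram_move"

definition is_unknot :: "diagram \<Rightarrow> bool" where
  "is_unknot D \<longleftrightarrow> same_link D [Cap 0, Cup 0]"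

text \<open>The double points of the free 2 1 n knot; \<open>Row k\<close> is the \<open>k\<close>-th crossing of the row,
  counted from the left starting with 1.\<close>

datatype crossing = L | R | B | Row nat

definition crossings :: "nat \<Rightarrow> crossing set" where
  "crossings n = {L, R, B} \<union> Row ` {1..n}"

text \<open>
  Below \<open>B\<close> there are four strands, which come from SW of \<open>L\<close>, SW of \<open>B\<close>, SE of \<open>B\<close> and SE of
  \<open>R\<close>, in this order. The caps in the third line are the upper arcs between consecutive crossings
  of the row (NE of \<open>Row k\<close> to NW of \<open>Row (k + 1)\<close>). After them, strands \<open>2 * k - 1\<close> and \<open>2 * k\<close>
  enter \<open>Row k\<close> from above, in particular strand 1 (from \<open>B\<close>) enters at the upper-left end of the
  row and strand \<open>2 * n\<close> (from \<open>B\<close>) at its upper-right end. The \<open>n + 1\<close> cups at the bottom join,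
  from left to right, strands 0 and 1 (SW of \<open>L\<close> to the lower-left end of the row), the lower
  arcs of the row, and strands \<open>2 * n\<close> and \<open>2 * n + 1\<close> (the lower-right end of the row to SE of
  \<open>R\<close>). All of them are \<open>Cup 0\<close> since each one removes the two leftmost strands.
\<close>

definition free_21n :: "nat \<Rightarrow> crossing event list" where
  "free_21n n =
    [Cap 0, Cap 1,
     Cross 0 L, Cross 2 R, Cross 1 B] @
    map (\<lambda>k. Cap (2 * k)) [1..<n] @
    map (\<lambda>k. Cross (2 * k - 1) (Row k)) [1..<n + 1] @
    replicate (n + 1) (Cup 0)"

definition assignments :: "nat \<Rightarrow> (crossing \<Rightarrow> strand) set" where
  "assignments n = crossings n \<rightarrow>\<^sub>E UNIV"

definition diagram_of :: "nat \<Rightarrow> (crossing \<Rightarrow> strand) \<Rightarrow> diagram" where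
  "diagram_of n a = map (map_event a) (free_21n n)"

text \<open>Binomial coefficients with integer lower index, zero if that index is negative.\<close>

definition binom :: "nat \<Rightarrow> int \<Rightarrow> nat" where
  "binom n k = (if k < 0 then 0 else n choose nat k)"

lemma set_crossings_free_21n: "\<Union> (set_event ` set (free_21n n)) = crossings n"
  by (auto simp: free_21n_def crossings_def atLeastLessThanSuc_atLeastAtMost)

lemma width_append:
  "width w (xs @ ys) = (case width w xs of None \<Rightarrow> None | Some v \<Rightarrow> width v ys)"
  by (induction w xs rule: width.induct) auto

lemma closed_free_21n:
  assumes "n \<ge> 1"
  shows "is_closed (free_21n n)"
proof -
  have head: "width 0 [Cap 0, Cap 1, Cross 0 L, Cross 2 R, Cross 1 B] = Some 4"
    by simp
  have caps: "width 4 (map (\<lambda>k. Cap (2 * k)) [1..<m] :: crossing event list) = Some (2 * m + 2)"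
    if "m \<ge> 1" for m
    using that by (induction m rule: nat_induct_at_least) (auto simp: width_append)
  have row: "width (2 * n + 2) (map (\<lambda>k. Cross (2 * k - 1) (Row k)) [1..<m + 1]) = Some (2 * n + 2)"
    if "m \<le> n" for m
    using that by (induction m) (auto simp: width_append)
  have cups: "width (2 * m) (replicate m (Cup 0) :: crossing event list) = Some 0" for m
    by (induction m) auto
  have cups': "width (2 * n + 2) (replicate (n + 1) (Cup 0) :: crossing event list) = Some 0"
    using cups[of "n + 1"] by simp
  show ?thesis
    unfolding is_closed_def free_21n_def width_append head option.case caps[OF assms]
      row[OF order.refl] cups' ..
qed

lemma closed_map_event: "is_closed (map (map_event a) D) = is_closed D"
proof -
  have [simp]: "pos (map_event a e) = pos e" "strands_in (map_event a e) = strands_in e"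
      "strands_out (map_event a e) = strands_out e" for e
    by (cases e; simp)+
  have "width w (map (map_event a) D) = width w D" for w
    by (induction w D rule: width.induct) auto
  then show ?thesis by (simp add: is_closed_def)
qed

end

theory Submission
  imports Defs
begin

text \<open>
  The row can be slid to the left, one crossing at a time, which turns the diagram into a plat on
  four strands whose first two strands carry a word of twists; only the signed sum of the word
  matters. If \<open>L\<close> and \<open>R\<close> cancel, the plat is a closed twist with the sum \<open>s\<close> of the row. If they
  agree with each other and with \<open>B\<close>, a Reidemeister move III turns the head into two opposite
  twists. In the remaining case the head is a clasp. Closed twists have determinant \<open>\<bar>s\<bar>\<close>, clasps
  \<open>\<bar>3 * s \<plusminus> 2\<bar>\<close>. The diagrams of determinant 1 are unknotted by explicit moves; for the others a divisor
  \<open>m > 1\<close> of the determinant yields a nonconstant Fox colouring modulo \<open>m\<close>.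
\<close>

section \<open>Equivalence of tangles\<close>

text \<open>Moves are defined for closed diagrams only, so open pieces are compared inside all
  closed completions, \<open>w\<close> being the number of strands that enter from above. Equal
  widths let closedness pass from one side to the other.\<close>

definition teq :: "nat \<Rightarrow> diagram \<Rightarrow> diagram \<Rightarrow> bool" where
  "teq w l r \<longleftrightarrow> width w l = width w r \<and>
    (\<forall>xs ys. width 0 xs = Some w \<longrightarrow> is_closed (xs @ l @ ys) \<longrightarrow>
      same_link (xs @ l @ ys) (xs @ r @ ys))"

lemma same_link_refl: "same_link D D"
  by (simp add: same_link_def)

lemma same_link_sym: "same_link D E \<Longrightarrow> same_link E D"
  by (simp add: same_link_def equivclp_sym)

lemma same_link_trans: "same_link D E \<Longrightarrow> same_link E F \<Longrightarrow> same_link D F"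
  unfolding same_link_def by (rule equivclp_trans)

lemma is_closed_replace:
  assumes "width 0 xs = Some w" "width w l = width w r"
  shows "is_closed (xs @ l @ ys) \<longleftrightarrow> is_closed (xs @ r @ ys)"
  using assms by (simp add: is_closed_def width_append)

lemma teq_width: "teq w l r \<Longrightarrow> width w l = width w r"
  by (simp add: teq_def)

lemma teq_refl: "teq w l l"
  by (simp add: teq_def same_link_refl)

lemma teq_sym: "teq w l r \<Longrightarrow> teq w r l"
  unfolding teq_def using is_closed_replace[of _ w l r] same_link_sym by auto

lemma teq_trans [trans]: "teq w l r \<Longrightarrow> teq w r t \<Longrightarrow> teq w l t"
  unfolding teq_def using is_closed_replace[of _ w l r] same_link_trans by (auto 4 4)

text \<open>Contexts nest, so an equivalence may be applied anywhere inside a tangle. If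
  \<open>xs\<close> does not fit on \<open>w\<close> strands, no completion is closed and the claim
  is vacuous.\<close>

lemma teq_context:
  assumes "\<And>v. width w xs = Some v \<Longrightarrow> teq v l r"
  shows "teq w (xs @ l @ ys) (xs @ r @ ys)"
proof (cases "width w xs")
  case None
  then show ?thesis
    by (auto simp: teq_def width_append is_closed_def split: option.splits)
next
  case (Some v)
  then have *: "teq v l r" by (rule assms)
  have "same_link (as @ (xs @ l @ ys) @ bs) (as @ (xs @ r @ ys) @ bs)"
    if "width 0 as = Some w" "is_closed (as @ (xs @ l @ ys) @ bs)" for as bs
  proof -
    have "width 0 (as @ xs) = Some v"
      using that Some by (simp add: width_append)
    moreover have "is_closed ((as @ xs) @ l @ (ys @ bs))"
      using that by simp
    ultimately have "same_link ((as @ xs) @ l @ (ys @ bs)) ((as @ xs) @ r @ (ys @ bs))"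
      using * unfolding teq_def by blast
    then show ?thesis by simp
  qed
  with Some teq_width[OF *] show ?thesis
    by (auto simp: teq_def width_append)
qed

lemma teq_append: "teq w l r \<Longrightarrow> teq w (l @ ys) (r @ ys)"
  using teq_context[of w "[]" l r ys] by simp

text \<open>Equal widths supply the closedness of the second diagram, which a move presupposes.
  Giving \<open>x\<close> and \<open>y\<close> by equations allows concrete event lists to be
  matched by simplification.\<close>

lemma teq_move:
  assumes "local_move l r" "x = xs @ l @ ys" "y = xs @ r @ ys" "width w x = width w y"
  shows "teq w x y"
  unfolding teq_def
proof (intro conjI allI impI)
  fix as bs
  assume *: "width 0 as = Some w" "is_closed (as @ x @ bs)"
  then have "is_closed (as @ y @ bs)"
    using assms(4) is_closed_replace by blast
  with * assms have "diagram_move ((as @ xs) @ l @ (ys @ bs)) ((as @ xs) @ r @ (ys @ bs))"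
    by (intro diagram_move.intros) auto
  then show "same_link (as @ x @ bs) (as @ y @ bs)"
    using assms by (simp add: same_link_def r_into_equivclp)
qed (use assms in simp)

lemma teq_move':
  assumes "local_move l r" "x = xs @ r @ ys" "y = xs @ l @ ys" "width w x = width w y"
  shows "teq w x y"
  using assms by (intro teq_sym[OF teq_move]) auto

lemma same_link_teq: "teq 0 D E \<Longrightarrow> is_closed D \<Longrightarrow> same_link D E"
  unfolding teq_def by (metis append_Nil append_Nil2 width.simps(1))

lemma is_unknot_teq:
  assumes "teq 0 D E" "is_closed D"
  shows "is_unknot D \<longleftrightarrow> is_unknot E"
  using same_link_teq[OF assms] same_link_sym same_link_trans unfolding is_unknot_def by blast

lemma other_other [simp]: "other (other c) = c"
  by (cases c) auto

lemma pos_shift [simp]: "pos (shift k e) = pos e + k"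
  and strands_in_shift [simp]: "strands_in (shift k e) = strands_in e"
  and strands_out_shift [simp]: "strands_out (shift k e) = strands_out e"
  by (cases e; simp)+

lemma shift_0 [simp]: "shift 0 e = e"
  by (cases e) auto

section \<open>Sliding the row to the left\<close>

lemma teq_exchange:
  assumes "pos e \<le> pos f"
  shows "teq w [e, shift (strands_out e) f] [shift (strands_in e) f, e]"
  by (rule teq_move[OF exchange[OF assms], of _ "[]" "[]"]) (use assms in auto)

text \<open>The event \<open>e\<close> moves down past the list one event at a time. Each index
  changes from counting the strands below \<open>e\<close> to counting those above it.\<close>

lemma teq_exchange_list:
  assumes "\<And>f. f \<in> set fs \<Longrightarrow> pos e \<le> pos f"
  shows "teq w (e # map (shift (strands_out e)) fs) (map (shift (strands_in e)) fs @ [e])"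
  using assms
proof (induction fs arbitrary: w)
  case Nil
  show ?case by (simp add: teq_refl)
next
  case (Cons f fs)
  let ?o = "shift (strands_out e)" and ?i = "shift (strands_in e)"
  have "teq w ([e, ?o f] @ map ?o fs) ([?i f, e] @ map ?o fs)"
    by (intro teq_append teq_exchange) (simp add: Cons.prems)
  moreover have "teq w ([?i f] @ (e # map ?o fs) @ []) ([?i f] @ (map ?i fs @ [e]) @ [])"
    by (intro teq_context Cons.IH) (simp add: Cons.prems)
  ultimately show ?case
    by (auto intro: teq_trans)
qed

lemma teq_exchange_Cup: "teq w (map (shift 2) fs @ [Cup 0]) (Cup 0 # fs)"
  using teq_exchange_list[of fs "Cup 0" w, THEN teq_sym] by (simp add: map_idI)

lemma teq_exchange_Cross:
  assumes "\<And>f. f \<in> set fs \<Longrightarrow> pos f \<ge> i"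
  shows "teq w (map (shift 2) fs @ [Cross i c]) (Cross i c # map (shift 2) fs)"
  using teq_exchange_list[of fs "Cross i c" w, THEN teq_sym] assms by simp

text \<open>The leftmost crossing of a row, together with the arc to the next crossing and the cup
  that closes it on the left, is a crossing turned by a quarter. Straightening it gives a twist of
  the first two strands, and the turn swaps the names of its strands.\<close>

lemma teq_row_crossing: "teq 4 [Cap 2, Cross 1 c, Cup 0] [Cross 0 (other c)]"
proof -
  have "teq 4 [Cap 2, Cross 1 c, Cup 0] [Cap 1, Cross 2 (other c), Cup 0]"
    by (rule teq_move'[OF slide_cap[of 1 "other c"], of _ "[]" "[Cup 0]"])
      simp_all
  also have "teq 4 \<dots> [Cap 1, Cup 0, Cross 0 (other c)]"
    by (rule teq_move'[OF exchange[of "Cup 0" "Cross 0 (other c)"], of _ "[Cap 1]" "[]"])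
      simp_all
  also have "teq 4 \<dots> [Cross 0 (other c)]"
    by (rule teq_move[OF zigzag_right[of 0], of _ "[]" "[Cross 0 (other c)]"]) auto
  finally show ?thesis .
qed

text \<open>Induction from the left end: the first arc, crossing and cup are brought together and
  straightened, and what remains is a row with one crossing fewer, all of whose indices have dropped
  by 2.\<close>

lemma teq_row:
  assumes "n \<ge> 1"
  shows "teq 4
    (map (\<lambda>k. Cap (2 * k)) [1..<n] @ map (\<lambda>k. Cross (2 * k - 1) (f k)) [1..<n + 1] @
      replicate (n + 1) (Cup 0))
    (map (\<lambda>k. Cross 0 (other (f k))) [1..<n + 1] @ [Cup 1, Cup 0])"
  using assms
proof (induction n arbitrary: f rule: nat_induct_at_least)
  case base
  show ?case
    by (rule teq_move'[OF slide_cup[of 0 "other (f 1)"], of _ "[]" "[Cup 0]"])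
      simp_all
next
  case (Suc n)
  let ?caps = "map (\<lambda>k. Cap (2 * k)) [1..<n] :: diagram"
  let ?crosses = "map (\<lambda>k. Cross (2 * k - 1) (f (Suc k))) [1..<n + 1]"
  let ?cups = "replicate (n + 1) (Cup 0) :: diagram"
  have "[1..<Suc n] = 1 # map Suc [1..<n]" "[1..<Suc n + 1] = 1 # map Suc [1..<n + 1]"
    using \<open>n \<ge> 1\<close> by (simp_all add: map_Suc_upt upt_conv_Cons del: upt_Suc)
  note upt = this
  have caps: "map (\<lambda>k. Cap (2 * k)) [1..<Suc n] = Cap 2 # map (shift 2) ?caps"
    unfolding upt by simp
  have crosses: "map (\<lambda>k. Cross (2 * k - 1) (f k)) [1..<Suc n + 1] =
      Cross 1 (f 1) # map (shift 2) ?crosses"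
    unfolding upt by auto
  have row: "map (\<lambda>k. Cross 0 (other (f k))) [1..<Suc n + 1] =
      Cross 0 (other (f 1)) # map (\<lambda>k. Cross 0 (other (f (Suc k)))) [1..<n + 1]"
    unfolding upt by (simp add: comp_def)
  \<comment> \<open>Three exchanges bring the pieces together: the first cup rises past the later
    crossings, the first crossing rises past the later caps, and then the cup rises past these caps
    as well.\<close>
  have "teq 4
      ((Cap 2 # map (shift 2) ?caps @ [Cross 1 (f 1)]) @ (map (shift 2) ?crosses @ [Cup 0]) @ ?cups)
      ((Cap 2 # map (shift 2) ?caps @ [Cross 1 (f 1)]) @ (Cup 0 # ?crosses) @ ?cups)"
    by (intro teq_context teq_exchange_Cup)
  also have "\<dots> = [Cap 2] @ (map (shift 2) ?caps @ [Cross 1 (f 1)]) @ (Cup 0 # ?crosses @ ?cups)"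
    by simp
  also have "teq 4 \<dots> ([Cap 2] @ (Cross 1 (f 1) # map (shift 2) ?caps) @ (Cup 0 # ?crosses @ ?cups))"
    by (intro teq_context teq_exchange_Cross) auto
  also have "\<dots> = [Cap 2, Cross 1 (f 1)] @ (map (shift 2) ?caps @ [Cup 0]) @ (?crosses @ ?cups)"
    by simp
  also have "teq 4 \<dots> ([Cap 2, Cross 1 (f 1)] @ (Cup 0 # ?caps) @ (?crosses @ ?cups))"
    by (intro teq_context teq_exchange_Cup)
  also have "\<dots> = [Cap 2, Cross 1 (f 1), Cup 0] @ (?caps @ ?crosses @ ?cups)"
    by simp
  also have "teq 4 \<dots> ([Cross 0 (other (f 1))] @ (?caps @ ?crosses @ ?cups))"
    by (intro teq_append teq_row_crossing)
  also have "teq 4 \<dots> ([Cross 0 (other (f 1))] @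
      (map (\<lambda>k. Cross 0 (other (f (Suc k)))) [1..<n + 1] @ [Cup 1, Cup 0]) @ [])"
    using teq_context[of 4 "[Cross 0 (other (f 1))]" _ _ "[]"] Suc.IH[of "\<lambda>k. f (Suc k)"] by simp
  finally show ?case
    unfolding caps crosses row by (simp add: replicate_append_same)
qed

section \<open>Plats\<close>

text \<open>The sign of a half twist of two vertical strands, independent of orientations; adjacent
  twists of opposite value cancel by a Reidemeister move II.\<close>

fun val :: "strand \<Rightarrow> int" where
  "val NW_SE = 1"
| "val NE_SW = - 1"

lemma val_other [simp]: "val (other c) = - val c"
  by (cases c) auto

definition twist_word :: "int \<Rightarrow> strand list" where
  "twist_word s = replicate (nat \<bar>s\<bar>) (if s \<ge> 0 then NW_SE else NE_SW)"

text \<open>A letter put in front of a normal form either cancels against its first letter or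
  prolongs it. Which one happens depends on the sign of \<open>s\<close>.\<close>

lemma twist_word_add:
  "(\<exists>ws. twist_word (val c + s) = ws \<and> twist_word s = other c # ws) \<or>
   twist_word (val c + s) = c # twist_word s"
proof -
  have "nat \<bar>s\<bar> = Suc (nat \<bar>1 + s\<bar>)" if "s < 0"
    using that by simp
  moreover have "nat \<bar>s\<bar> = Suc (nat \<bar>s - 1\<bar>)" if "s > 0"
    using that by simp
  moreover have "nat \<bar>1 + s\<bar> = Suc (nat \<bar>s\<bar>)" if "s \<ge> 0"
    using that by simp
  moreover have "nat \<bar>s - 1\<bar> = Suc (nat \<bar>s\<bar>)" if "s \<le> 0"
    using that by simp
  ultimately show ?thesis
    by (cases c; cases s "0 :: int" rule: linorder_cases) (auto simp: twist_word_def)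
qed

lemma teq_twist_word:
  assumes "w \<ge> 2"
  shows "teq w (map (Cross 0) ws) (map (Cross 0) (twist_word (sum_list (map val ws))))"
proof (induction ws)
  case Nil
  show ?case by (simp add: twist_word_def teq_refl)
next
  case (Cons c ws)
  let ?s = "sum_list (map val ws)"
  have "teq w ([Cross 0 c] @ map (Cross 0) ws @ []) ([Cross 0 c] @ map (Cross 0) (twist_word ?s) @ [])"
  proof (rule teq_context)
    show "teq v (map (Cross 0) ws) (map (Cross 0) (twist_word ?s))" if "width w [Cross 0 c] = Some v" for v
    proof -
      have "v = w" using that assms by simp
      with Cons.IH show ?thesis by simp
    qed
  qed
  moreover have "teq w ([Cross 0 c] @ map (Cross 0) (twist_word ?s))
      (map (Cross 0) (twist_word (val c + ?s)))"
    using twist_word_add[of c ?s]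
  proof
    assume "\<exists>vs. twist_word (val c + ?s) = vs \<and> twist_word ?s = other c # vs"
    then obtain vs where vs: "twist_word (val c + ?s) = vs" "twist_word ?s = other c # vs"
      by blast
    have "teq w [Cross 0 c, Cross 0 (other c)] []"
      by (rule teq_move[OF r2[of 0 c], of _ "[]" "[]"]) (use assms in auto)
    from teq_append[OF this, of "map (Cross 0) vs"] show ?thesis
      by (simp add: vs)
  qed (simp add: teq_refl)
  ultimately show ?case
    by (auto intro: teq_trans)
qed

lemma teq_sum_eq:
  assumes "w \<ge> 2" "sum_list (map val vs) = sum_list (map val ws)"
  shows "teq w (map (Cross 0) vs) (map (Cross 0) ws)"
  using teq_twist_word[OF assms(1)] assms(2) teq_sym teq_trans by metis

text \<open>Caps and cups are nested: the outer ones join strands 0 and 3, the inner ones strands 1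
  and 2. For empty \<open>D\<close> this is the closure of a 2-strand braid, a torus link of type
  (2, s) with s the sum of the word.\<close>

definition plat :: "diagram \<Rightarrow> strand list \<Rightarrow> diagram" where
  "plat D ws = [Cap 0, Cap 1] @ D @ map (Cross 0) ws @ [Cup 1, Cup 0]"

lemma width_twists: "width 4 (map (Cross 0) ws) = Some 4"
  by (induction ws) auto

lemma closed_plat: "width 4 D = Some 4 \<Longrightarrow> is_closed (plat D ws)"
proof -
  assume D: "width 4 D = Some 4"
  have "width 0 ([Cap 0, Cap 1] :: diagram) = Some 4" "width 4 ([Cup 1, Cup 0] :: diagram) = Some 0"
    by simp_all
  then show ?thesis
    unfolding plat_def is_closed_def width_append by (simp only: D width_twists option.case)
qed

lemma teq_plat_head:
  assumes "teq 0 ([Cap 0, Cap 1] @ D) ([Cap 0, Cap 1] @ E @ map (Cross 0) us)"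
  shows "teq 0 (plat D ws) (plat E (us @ ws))"
  using teq_append[OF assms, of "map (Cross 0) ws @ [Cup 1, Cup 0]"] by (simp add: plat_def)

lemma teq_plat_sum_eq:
  assumes "sum_list (map val vs) = sum_list (map val ws)" "width 4 D = Some 4"
  shows "teq 0 (plat D vs) (plat D ws)"
proof -
  have "width 0 ([Cap 0, Cap 1] @ D) = Some 4"
    using assms(2) by (simp add: width_append eval_nat_numeral)
  then have "teq v (map (Cross 0) vs) (map (Cross 0) ws)"
    if "width 0 ([Cap 0, Cap 1] @ D) = Some v" for v
    using that teq_sum_eq[OF _ assms(1), of 4] by simp
  from teq_context[where w = 0 and xs = "[Cap 0, Cap 1] @ D", OF this, where ys = "[Cup 1, Cup 0]"]
  show ?thesis
    by (simp add: plat_def)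
qed

section \<open>The three crossings above the row\<close>

lemma teq_caps_cross_2: "teq 0 [Cap 0, Cap 1, Cross 2 c] [Cap 0, Cap 1, Cross 0 c]"
proof -
  \<comment> \<open>The crossing of the two right legs travels over the top of the nested caps to
    the left legs. It is turned twice, so its name is restored.\<close>
  have "teq 0 [Cap 0, Cap 1, Cross 2 c] [Cap 0, Cap 2, Cross 1 (other c)]"
    by (rule teq_move[OF slide_cap[of 1 c], of _ "[Cap 0]" "[]"]) auto
  also have "teq 0 \<dots> [Cap 0, Cap 0, Cross 1 (other c)]"
    by (rule teq_move[OF exchange[of "Cap 0" "Cap 0"], of _ "[]" "[Cross 1 (other c)]"])
      auto
  also have "teq 0 \<dots> [Cap 0, Cap 1, Cross 0 c]"
    by (rule teq_move[OF slide_cap[of 0 "other c"], of _ "[Cap 0]" "[]"]) auto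
  finally show ?thesis .
qed

lemma teq_head:
  "teq 0 [Cap 0, Cap 1, Cross 0 c, Cross 2 d, Cross 1 b] [Cap 0, Cap 1, Cross 0 d, Cross 0 c, Cross 1 b]"
proof -
  have "teq 0 [Cap 0, Cap 1, Cross 0 c, Cross 2 d, Cross 1 b]
      [Cap 0, Cap 1, Cross 2 d, Cross 0 c, Cross 1 b]"
    by (rule teq_move[OF exchange[of "Cross 0 c" "Cross 0 d"], of _ "[Cap 0, Cap 1]" "[Cross 1 b]"])
      auto
  also have "teq 0 \<dots> [Cap 0, Cap 1, Cross 0 d, Cross 0 c, Cross 1 b]"
    using teq_append[OF teq_caps_cross_2[of d], of "[Cross 0 c, Cross 1 b]"] by simp
  finally show ?thesis .
qed

text \<open>Once \<open>L\<close> and \<open>R\<close> have cancelled, \<open>B\<close> is a kink on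
  the inner cap.\<close>

lemma teq_cancelling_clasp:
  "teq 0 [Cap 0, Cap 1, Cross 0 (other c), Cross 0 c, Cross 1 b] [Cap 0, Cap 1]"
proof -
  have "teq 0 [Cap 0, Cap 1, Cross 0 (other c), Cross 0 c, Cross 1 b] [Cap 0, Cap 1, Cross 1 b]"
    by (rule teq_move[OF r2[of 0 "other c"], of _ "[Cap 0, Cap 1]" "[Cross 1 b]"]) auto
  also have "teq 0 \<dots> [Cap 0, Cap 1]"
    by (rule teq_move[OF r1_cap[of 1 b], of _ "[Cap 0]" "[]"]) auto
  finally show ?thesis .
qed

text \<open>Sliding the first crossing to another leg makes a move III possible, after which one
  crossing is a kink on a cap. Sliding back turns the next crossing into a second opposite
  twist.\<close>

lemma teq_coherent_clasp:
  "teq 0 [Cap 0, Cap 1, Cross 0 c, Cross 0 c, Cross 1 c]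
    [Cap 0, Cap 1, Cross 0 (other c), Cross 0 (other c)]"
proof -
  have "teq 0 [Cap 0, Cap 1, Cross 0 c, Cross 0 c, Cross 1 c]
      [Cap 0, Cap 0, Cross 1 (other c), Cross 0 c, Cross 1 c]"
    by (rule teq_move'[OF slide_cap[of 0 "other c"], of _ "[Cap 0]" "[Cross 0 c, Cross 1 c]"]) auto
  also have "teq 0 \<dots> [Cap 0, Cap 0, Cross 0 c, Cross 1 c, Cross 0 (other c)]"
    by (rule teq_move'[OF r3[of c c "other c" 0], of _ "[Cap 0, Cap 0]" "[]"]) auto
  also have "teq 0 \<dots> [Cap 0, Cap 0, Cross 1 c, Cross 0 (other c)]"
    by (rule teq_move[OF r1_cap[of 0 c], of _ "[Cap 0]" "[Cross 1 c, Cross 0 (other c)]"]) auto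
  also have "teq 0 \<dots> [Cap 0, Cap 1, Cross 0 (other c), Cross 0 (other c)]"
    by (rule teq_move[OF slide_cap[of 0 c], of _ "[Cap 0]" "[Cross 0 (other c)]"]) auto
  finally show ?thesis .
qed

definition clasp :: "strand \<Rightarrow> diagram" where
  "clasp c = [Cross 0 c, Cross 0 c, Cross 1 (other c)]"

text \<open>By a move III each of the two twists passes below the remaining crossings, where it
  becomes a kink on the inner cup. Then \<open>B\<close> is a kink on the inner cap, and only the
  twist of the row is left.\<close>

lemma teq_clasp: "teq 0 (plat (clasp c) [other c]) (plat [] [other c])"
proof -
  let ?o = "other c"
  have "teq 0 [Cap 0, Cap 1, Cross 0 c, Cross 0 c, Cross 1 ?o, Cross 0 ?o, Cup 1, Cup 0]
      [Cap 0, Cap 1, Cross 0 c, Cross 1 ?o, Cross 0 ?o, Cross 1 c, Cup 1, Cup 0]"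
    by (rule teq_move[OF r3[of c ?o ?o 0], of _ "[Cap 0, Cap 1, Cross 0 c]" "[Cup 1, Cup 0]"]) auto
  also have "teq 0 \<dots> [Cap 0, Cap 1, Cross 0 c, Cross 1 ?o, Cross 0 ?o, Cup 1, Cup 0]"
    by (rule teq_move[OF r1_cup[of 1 c],
          of _ "[Cap 0, Cap 1, Cross 0 c, Cross 1 ?o, Cross 0 ?o]" "[Cup 0]"]) auto
  also have "teq 0 \<dots> [Cap 0, Cap 1, Cross 1 ?o, Cross 0 ?o, Cross 1 c, Cup 1, Cup 0]"
    by (rule teq_move[OF r3[of c ?o ?o 0], of _ "[Cap 0, Cap 1]" "[Cup 1, Cup 0]"]) auto
  also have "teq 0 \<dots> [Cap 0, Cap 1, Cross 0 ?o, Cross 1 c, Cup 1, Cup 0]"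
    by (rule teq_move[OF r1_cap[of 1 ?o], of _ "[Cap 0]" "[Cross 0 ?o, Cross 1 c, Cup 1, Cup 0]"]) auto
  also have "teq 0 \<dots> [Cap 0, Cap 1, Cross 0 ?o, Cup 1, Cup 0]"
    by (rule teq_move[OF r1_cup[of 1 c], of _ "[Cap 0, Cap 1, Cross 0 ?o]" "[Cup 0]"]) auto
  finally show ?thesis
    by (simp add: plat_def clasp_def)
qed

lemma is_unknot_plat_1: "is_unknot (plat [] [c])"
proof -
  have "teq 0 [Cap 0, Cap 1, Cross 0 c, Cup 1, Cup 0] [Cap 0, Cap 1, Cross 1 (other c), Cup 0, Cup 0]"
    by (rule teq_move[OF slide_cup[of 0 c], of _ "[Cap 0, Cap 1]" "[Cup 0]"]) auto
  also have "teq 0 \<dots> [Cap 0, Cap 1, Cup 0, Cup 0]"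
    by (rule teq_move[OF r1_cap[of 1 "other c"], of _ "[Cap 0]" "[Cup 0, Cup 0]"]) auto
  also have "teq 0 \<dots> [Cap 0, Cup 0]"
    by (rule teq_move[OF zigzag_right[of 0], of _ "[Cap 0]" "[Cup 0]"]) auto
  finally have "teq 0 (plat [] [c]) [Cap 0, Cup 0]"
    by (simp add: plat_def)
  then show ?thesis
    unfolding is_unknot_def by (rule same_link_teq) (simp add: closed_plat)
qed

section \<open>Kei colourings\<close>

text \<open>
  A state labels infinitely many strands, so that the moves need no side conditions on widths.
  The labels occurring in a colouring are collected in the set \<open>X\<close>, since a nonconstant colouring
  may consist of states each of which is constant on the diagram.
\<close>

type_synonym 'a labelling = "nat \<Rightarrow> 'a"

lemma ex_ex_eq_conj: "(\<exists>s. (\<exists>x. s = f x) \<and> P s) \<longleftrightarrow> (\<exists>x. P (f x))"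
  by auto

lemma Suc_Suc_diff_2: "2 \<le> x \<Longrightarrow> Suc (Suc (x - 2)) = x"
  by simp

text \<open>A kei is an involutory quandle. The law \<open>act_act\<close> is left
  self-distributivity rewritten by means of \<open>invol\<close>, in the form that Reidemeister III
  produces.\<close>

locale pointed_kei =
  fixes act :: "'a \<Rightarrow> 'a \<Rightarrow> 'a" (infixr "\<rhd>" 70) and e :: 'a
  assumes idem [simp]: "x \<rhd> x = x"
    and invol [simp]: "x \<rhd> (x \<rhd> y) = y"
    and act_act: "(x \<rhd> y) \<rhd> z = x \<rhd> (y \<rhd> (x \<rhd> z))"
    and base_left [simp]: "e \<rhd> x = x"
    and base_right [simp]: "x \<rhd> e = e"
begin

definition cap :: "nat \<Rightarrow> 'a \<Rightarrow> 'a labelling \<Rightarrow> 'a labelling" where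
  "cap i x u = (\<lambda>j. if j < i then u j else if j < i + 2 then x else u (j - 2))"

definition cup :: "nat \<Rightarrow> 'a labelling \<Rightarrow> 'a labelling" where
  "cup i u = (\<lambda>j. if j < i then u j else u (j + 2))"

fun cross :: "nat \<Rightarrow> strand \<Rightarrow> 'a labelling \<Rightarrow> 'a labelling" where
  "cross i NW_SE u = u(i := u i \<rhd> u (i + 1), i + 1 := u i)"
| "cross i NE_SW u = u(i := u (i + 1), i + 1 := u (i + 1) \<rhd> u i)"

fun step :: "strand event \<Rightarrow> 'a labelling \<Rightarrow> 'a labelling \<Rightarrow> bool" where
  "step (Cap i) u v \<longleftrightarrow> (\<exists>x. v = cap i x u)"
| "step (Cup i) u v \<longleftrightarrow> u i = u (i + 1) \<and> v = cup i u"
| "step (Cross i c) u v \<longleftrightarrow> v = cross i c u"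

fun colouring :: "diagram \<Rightarrow> 'a labelling \<Rightarrow> 'a labelling \<Rightarrow> 'a set \<Rightarrow> bool" where
  "colouring [] u v X \<longleftrightarrow> u = v \<and> X = range u"
| "colouring (a # D) u v X \<longleftrightarrow> (\<exists>s Y. step a u s \<and> colouring D s v Y \<and> X = range u \<union> Y)"

definition colours :: "diagram \<Rightarrow> 'a labelling \<Rightarrow> 'a labelling \<Rightarrow> bool" where
  "colours D u v \<longleftrightarrow> (\<exists>X. colouring D u v X)"

lemma colours_Nil [simp]: "colours [] u v \<longleftrightarrow> u = v"
  by (simp add: colours_def)

lemma colours_Cons [simp]: "colours (a # D) u v \<longleftrightarrow> (\<exists>s. step a u s \<and> colours D s v)"
  by (auto simp: colours_def)

lemma colouring_append:
  "colouring (D @ E) u v X \<longleftrightarrow> (\<exists>s Y Z. colouring D u s Y \<and> colouring E s v Z \<and> X = Y \<union> Z)"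
proof (induction D arbitrary: u X)
  case Nil
  \<comment> \<open>The state at the joint is counted by both parts, which the union
    absorbs.\<close>
  have "range u \<subseteq> Z" if "colouring E u v Z" for Z
    using that by (cases E) auto
  then show ?case by (auto simp: Un_absorb1)
next
  case (Cons a D)
  show ?case by (simp add: Cons.IH) (metis Un_assoc)
qed

lemma range_top: "colouring D u v X \<Longrightarrow> range u \<subseteq> X"
  by (cases D) auto

lemma range_bottom: "colouring D u v X \<Longrightarrow> range v \<subseteq> X"
  by (induction D arbitrary: u X) (auto, blast)

section \<open>Commutation rules for states\<close>

lemma cup_cap_left [simp]: "cup (Suc i) (cap i x u) = u(i := x)"
  and cup_cap_right [simp]: "cup i (cap (Suc i) x u) = u(i := x)"
  by (auto simp: fun_eq_iff cup_def cap_def)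

lemma cap_nth [simp]:
  "j < i \<Longrightarrow> cap i x u j = u j" "cap i x u i = x" "cap i x u (Suc i) = x"
  "j \<ge> i \<Longrightarrow> cap i x u (Suc (Suc j)) = u j"
  by (auto simp: cap_def)

lemma cup_nth [simp]:
  "j < i \<Longrightarrow> cup i u j = u j" "j \<ge> i \<Longrightarrow> cup i u j = u (Suc (Suc j))"
  by (auto simp: cup_def)

lemma cap_cap: "i \<le> j \<Longrightarrow> cap (Suc (Suc j)) y (cap i x u) = cap i x (cap j y u)"
  by (auto simp: fun_eq_iff cap_def)

lemma cup_cap: "i \<le> j \<Longrightarrow> cup (Suc (Suc j)) (cap i x u) = cap i x (cup j u)"
  "i \<le> j \<Longrightarrow> cap j x (cup i u) = cup i (cap (Suc (Suc j)) x u)"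
  by (auto simp: fun_eq_iff cap_def cup_def Suc_diff_le Suc_Suc_diff_2)

lemma cup_cup: "i \<le> j \<Longrightarrow> cup j (cup i u) = cup i (cup (Suc (Suc j)) u)"
  by (auto simp: fun_eq_iff cup_def)

lemma cross_cap: "i \<le> j \<Longrightarrow> cross (Suc (Suc j)) c (cap i x u) = cap i x (cross j c u)"
  "Suc i < j \<Longrightarrow> cap j x (cross i c u) = cross i c (cap j x u)"
  by (cases c; auto simp: fun_eq_iff cap_def Suc_diff_le)+

lemma cross_cup: "i \<le> j \<Longrightarrow> cross j c (cup i u) = cup i (cross (Suc (Suc j)) c u)"
  "Suc i < j \<Longrightarrow> cup j (cross i c u) = cross i c (cup j u)"
  by (cases c; auto simp: fun_eq_iff cup_def)+

lemma cross_cross: "Suc i < j \<Longrightarrow> cross j c (cross i d u) = cross i d (cross j c u)"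
  by (cases c; cases d; auto simp: fun_eq_iff)

lemma cross_nth [simp]:
  "j < i \<Longrightarrow> cross i c u j = u j"  "j > Suc i \<Longrightarrow> cross i c u j = u j"
  by (cases c; simp)+

text \<open>If the cap runs on top, its label survives the slide; if it runs below, the label of the
  slid cap is acted on by the transverse strand.\<close>

lemma cross_NW_SE_cap: "cross (Suc i) NW_SE (cap i x u) = cross i NE_SW (cap (Suc i) x u)"
  and cross_NE_SW_cap: "cross (Suc i) NE_SW (cap i x u) = cross i NW_SE (cap (Suc i) (u i \<rhd> x) u)"
  by (auto simp: fun_eq_iff cap_def less_Suc_eq not_less_eq)

text \<open>Here the cup runs on top, and the outgoing strand is acted on by one end of the cup or
  by the other. The results agree because the two ends carry the same label.\<close>

lemma cup_cross_NW_SE: "u i = u (i + 2) \<Longrightarrow> cup (Suc i) (cross i NW_SE u) = cup i (cross (Suc i) NE_SW u)"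
  and cup_cross_NE_SW: "cup (Suc i) (cross i NE_SW u) = cup i (cross (Suc i) NW_SE u)"
  by (rule ext; simp add: cup_def)+

lemma act_eq_left [simp]: "x \<rhd> y = x \<longleftrightarrow> y = x" "x = x \<rhd> y \<longleftrightarrow> y = x"
  by (metis idem invol)+

lemma cross_cap_same [simp]: "cross i c (cap i x u) = cap i x u"
  by (rule ext, cases c) (simp_all add: cap_def)

lemma cup_cross_same [simp]: "cup i (cross i c u) = cup i u"
  by (rule ext, cases c) (simp_all add: cup_def)

lemma cross_other [simp]: "cross i (other c) (cross i c u) = u"
  by (rule ext, cases c) simp_all

lemma cross_cross_cross:
  "a = b \<or> b = c \<Longrightarrow>
    cross i c (cross (Suc i) b (cross i a u)) = cross (Suc i) a (cross i b (cross (Suc i) c u))"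
  by (rule ext, cases a; cases b; cases c) (simp_all add: act_act)

text \<open>The two sides of a move relate the same top and bottom states. This transfers colourings
  but says nothing yet about the labels inside.\<close>

lemma colours_local_move: "local_move l r \<Longrightarrow> colours l u v \<longleftrightarrow> colours r u v"
proof (induction rule: local_move.induct)
  case (exchange a b)
  then show ?case
    by (cases a; cases b)
      (auto simp: ex_ex_eq_conj cap_cap cup_cap cup_cup cross_cap cross_cup cross_cross simp del: cross.simps)
next
  case (zigzag_left i)
  then show ?case by auto
next
  case (zigzag_right i)
  then show ?case by auto
next
  case (slide_cap i c)
  show ?case
  proof (cases c)
    case NW_SE
    then show ?thesis
      by (simp add: ex_ex_eq_conj cross_NW_SE_cap del: cross.simps)
  next
    case NE_SW
    \<comment> \<open>The label of the cap is existentially bound, so it may be changed by the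
      involution given by the action of \<open>u i\<close>.\<close>
    have "(\<exists>x. v = cross i NW_SE (cap (Suc i) (u i \<rhd> x) u)) \<longleftrightarrow>
        (\<exists>x. v = cross i NW_SE (cap (Suc i) x u))"
      by (metis invol)
    with NE_SW show ?thesis
      by (simp add: ex_ex_eq_conj cross_NE_SW_cap eq_commute del: cross.simps)
  qed
next
  case (slide_cup i c)
  show ?case
  proof (cases c)
    case NW_SE
    then show ?thesis
      using cup_cross_NW_SE[of u i] by (auto simp del: cross.simps) (auto)
  next
    case NE_SW
    have "u (Suc i) \<rhd> u i = u (i + 2) \<longleftrightarrow> u i = u (Suc i) \<rhd> u (i + 2)"
      by (metis invol)
    with NE_SW show ?thesis
      using cup_cross_NE_SW[of i u] by simp
  qed
next
  case (r1_cap i c)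
  then show ?case
    by (simp add: ex_ex_eq_conj del: cross.simps)
next
  case (r1_cup i c)
  have "cross i c u i = cross i c u (Suc i) \<longleftrightarrow> u i = u (Suc i)"
    by (cases c) auto
  then show ?case
    by (simp del: cross.simps)
next
  case (r2 i c)
  then show ?case by auto
next
  case (r3 a b c i)
  show ?case
    by (simp add: cross_cross_cross[OF r3] del: cross.simps)
qed

section \<open>Labels in the interior of a move\<close>

lemma range_cap: "range (cap i x u) = insert x (range u)"
proof (intro equalityI subsetI)
  fix y assume "y \<in> insert x (range u)"
  then consider "y = x" | j where "y = u j" by blast
  then show "y \<in> range (cap i x u)"
  proof cases
    case 1
    then show ?thesis by (metis cap_nth(2) rangeI)
  next
    case (2 j)
    then show ?thesis
      by (cases "j < i") (metis cap_nth(1) rangeI, metis cap_nth(4) not_less rangeI)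
  qed
qed (auto simp: cap_def)

lemma range_cup: "range (cup i u) \<subseteq> range u"
  by (auto simp: cup_def)

context
  fixes S :: "'a set"
  assumes act_closed: "\<And>x y. x \<in> S \<Longrightarrow> y \<in> S \<Longrightarrow> x \<rhd> y \<in> S"
begin

lemma cross_subset:
  assumes "range u \<subseteq> S"
  shows "range (cross i c u) \<subseteq> S"
proof -
  have "u j \<in> S" for j using assms by auto
  then show ?thesis by (cases c) (auto simp: act_closed)
qed

lemma step_subset_down:
  assumes "step a u s" "range u \<subseteq> S" "\<And>i. a \<noteq> Cap i"
  shows "range s \<subseteq> S"
proof (cases a)
  case (Cup i)
  with assms show ?thesis using range_cup[of i u] by auto
next
  case (Cross i c)
  with assms show ?thesis using cross_subset[OF assms(2)] by simp
qed (use assms in simp)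

lemma step_subset_up:
  assumes "step a s v" "range v \<subseteq> S" "\<And>i. a \<noteq> Cup i"
  shows "range s \<subseteq> S"
proof (cases a)
  case (Cross i c)
  with assms(1) have "s = cross i (other c) v" by simp
  then show ?thesis using cross_subset[OF assms(2)] by simp
qed (use assms in \<open>auto simp: range_cap\<close>)

text \<open>There is a single intermediate state. It is controlled from above unless the first event
  is a cap, and from below unless the second is a cup; only a cap followed by a cup could hide a
  label.\<close>

lemma colouring_pair_subset:
  assumes "colouring [a, b] u v X" "range u \<subseteq> S" "range v \<subseteq> S"
    and "\<And>i j. a \<noteq> Cap i \<or> b \<noteq> Cup j"
  shows "X \<subseteq> S"
proof -
  from assms(1) obtain s where s: "step a u s" "step b s v" "X = range u \<union> range s \<union> range v"
    by auto
  show ?thesis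
  proof (cases "\<exists>i. a = Cap i")
    case True
    with assms(4) have "range s \<subseteq> S"
      by (intro step_subset_up[OF s(2) assms(3)]) auto
    with s(3) assms(2,3) show ?thesis by simp
  next
    case False
    then have "range s \<subseteq> S"
      by (intro step_subset_down[OF s(1) assms(2)]) auto
    with s(3) assms(2,3) show ?thesis by simp
  qed
qed

text \<open>No side of a move contains a closed component, so all interior labels lie in any subkei
  that contains the boundary labels. The exchanges of a cap with a cup are treated separately, since
  there the label of the cap is read off from the bottom state.\<close>

lemma colouring_local_move_subset:
  assumes "local_move l r" "D = l \<or> D = r" "colouring D u v X"
    and S: "range u \<subseteq> S" "range v \<subseteq> S"
  shows "X \<subseteq> S"
proof -
  have u: "u j \<in> S" and v: "v j \<in> S" and cross: "cross i c u j \<in> S" for i j c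
    using S cross_subset[OF S(1), of i c] by auto
  have cap: "cap i x u j \<in> S" if "x \<in> S" for i x j
    using that u by (simp add: cap_def)
  show ?thesis
    using assms(1-3)
  proof (induction rule: local_move.induct)
    case (exchange a b)
    consider i j where "a = Cap i" "b = Cup j" | i j where "a = Cup i" "b = Cap j"
      | "\<nexists>i j. a = Cap i \<and> b = Cup j \<or> a = Cup i \<and> b = Cap j"
      by blast
    then show ?case
    proof cases
      case (1 i j)
      have "X \<subseteq> S" if D: "D = [Cap i, Cup (j + 2)]"
      proof -
        from exchange(3) D obtain x where
          x: "v = cup (Suc (Suc j)) (cap i x u)" "X = range u \<union> (range (cap i x u) \<union> range v)"
          by auto
        have "v = cap i x (cup j u)"
          using x(1) cup_cap(1) exchange(1) 1 by simp
        with x(2) S show ?thesis by (simp add: range_cap)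
      qed
      moreover have "D = [Cap i, Cup (j + 2)] \<or> D = [Cup j, Cap i]"
        using exchange(2) 1 by auto
      ultimately show ?thesis
        using colouring_pair_subset[OF _ S] exchange(3) by blast
    next
      case (2 i j)
      have "X \<subseteq> S" if D: "D = [Cap (j + 2), Cup i]"
      proof -
        from exchange(3) D obtain x where
          x: "v = cup i (cap (Suc (Suc j)) x u)" "X = range u \<union> (range (cap (Suc (Suc j)) x u) \<union> range v)"
          by auto
        have "v = cap j x (cup i u)"
          using x(1) cup_cap(2) exchange(1) 2 by simp
        with x(2) S show ?thesis by (simp add: range_cap)
      qed
      moreover have "D = [Cap (j + 2), Cup i] \<or> D = [Cup i, Cap j]"
        using exchange(2) 2 by auto
      ultimately show ?thesis
        using colouring_pair_subset[OF _ S] exchange(3) by blast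
    next
      case 3
      have "colouring [a, shift (strands_out a) b] u v X \<or> colouring [shift (strands_in a) b, a] u v X"
        using exchange(2,3) by (auto simp del: colouring.simps)
      then show ?thesis
      proof (elim disjE; intro colouring_pair_subset[OF _ S])
        show "a \<noteq> Cap i \<or> shift (strands_out a) b \<noteq> Cup j" for i j
          using 3 by (cases b) auto
        show "shift (strands_in a) b \<noteq> Cap i \<or> a \<noteq> Cup j" for i j
          using 3 by (cases b) auto
      qed
    qed
  next
    case (slide_cap i c)
    then have "colouring [Cap i, Cross (i + 1) c] u v X \<or>
        colouring [Cap (i + 1), Cross i (other c)] u v X" (is "?A \<or> ?B")
      by (auto simp del: colouring.simps)
    then show ?case
    proof
      assume ?A
      then show ?thesis by (rule colouring_pair_subset[OF _ S]) auto
    next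
      assume ?B
      then show ?thesis by (rule colouring_pair_subset[OF _ S]) auto
    qed
  next
    case (slide_cup i c)
    then have "colouring [Cross i c, Cup (i + 1)] u v X \<or>
        colouring [Cross (i + 1) (other c), Cup i] u v X" (is "?A \<or> ?B")
      by (auto simp del: colouring.simps)
    then show ?case
    proof
      assume ?A
      then show ?thesis by (rule colouring_pair_subset[OF _ S]) auto
    next
      assume ?B
      then show ?thesis by (rule colouring_pair_subset[OF _ S]) auto
    qed
  next
    case (r2 i c)
    have "range (cross i c u) \<subseteq> S"
      using S(1) by (rule cross_subset)
    moreover have "X = range u \<or> X = range u \<union> (range (cross i c u) \<union> range v)"
      using r2 by (auto simp del: cross.simps)
    ultimately show ?case using S by auto
  next
    case (r3 a b c i)
    have "X \<subseteq> S" if "colouring [Cross i a, Cross j b, Cross k c] u v X" for i j k a b c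
    proof -
      from that obtain s t where
        st: "s = cross i a u" "t = cross j b s" "X = range u \<union> (range s \<union> (range t \<union> range v))"
        by auto
      have "range s \<subseteq> S" "range t \<subseteq> S"
        unfolding st(1,2) by (intro cross_subset S(1))+
      with st(3) S show ?thesis by simp
    qed
    with r3 show ?case by (metis (no_types))
  qed (use S u v cross cap in \<open>auto simp: range_cap simp del: cross.simps\<close>)
qed

end

text \<open>By idempotence and the laws of the base point each set \<open>{e, b}\<close> is closed
  under the action, so the previous lemma applies to it. Hence a nontrivial colouring stays
  nontrivial when a move is made.\<close>

lemma colouring_local_move:
  assumes "local_move l r" "D = l \<and> E = r \<or> D = r \<and> E = l" "colouring D u v X"
  shows "\<exists>Y. colouring E u v Y \<and> (\<forall>b. Y \<subseteq> {e, b} \<longrightarrow> X \<subseteq> {e, b})"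
proof -
  have "colours D u v" using assms(3) by (auto simp: colours_def)
  then have "colours E u v" using assms(2) colours_local_move[OF assms(1)] by auto
  then obtain Y where Y: "colouring E u v Y" by (auto simp: colours_def)
  have "X \<subseteq> {e, b}" if "Y \<subseteq> {e, b}" for b
  proof (rule colouring_local_move_subset[OF _ assms(1) _ assms(3)])
    show "range u \<subseteq> {e, b}" "range v \<subseteq> {e, b}"
      using range_top[OF Y] range_bottom[OF Y] that by auto
  qed (use assms(2) in auto)
  with Y show ?thesis by blast
qed

text \<open>The strands to the right of the diagram are coloured by the base point, which acts trivially.\<close>

definition colourable :: "diagram \<Rightarrow> bool" where
  "colourable D \<longleftrightarrow> (\<exists>X. colouring D (\<lambda>_. e) (\<lambda>_. e) X \<and> (\<nexists>b. X \<subseteq> {e, b}))"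

lemma colourable_local_move:
  assumes "local_move l r" "D = l \<and> E = r \<or> D = r \<and> E = l" "colourable (xs @ D @ ys)"
  shows "colourable (xs @ E @ ys)"
proof -
  from assms(3) obtain X where X: "colouring (xs @ D @ ys) (\<lambda>_. e) (\<lambda>_. e) X" "\<nexists>b. X \<subseteq> {e, b}"
    unfolding colourable_def by blast
  from X(1) obtain s t P Q T where *: "colouring xs (\<lambda>_. e) s P" "colouring D s t Q"
      "colouring ys t (\<lambda>_. e) T" "X = P \<union> (Q \<union> T)"
    unfolding colouring_append by blast
  obtain Q' where Q': "colouring E s t Q'" "\<And>b. Q' \<subseteq> {e, b} \<Longrightarrow> Q \<subseteq> {e, b}"
    using colouring_local_move[OF assms(1,2) *(2)] by blast
  have "colouring (xs @ E @ ys) (\<lambda>_. e) (\<lambda>_. e) (P \<union> (Q' \<union> T))"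
    unfolding colouring_append using * Q'(1) by blast
  moreover have "\<nexists>b. P \<union> (Q' \<union> T) \<subseteq> {e, b}"
    using X(2) *(4) Q'(2) by (metis Un_subset_iff)
  ultimately show ?thesis unfolding colourable_def by blast
qed

lemma colourable_diagram_move: "diagram_move D E \<Longrightarrow> colourable D \<longleftrightarrow> colourable E"
  by (induction rule: diagram_move.induct) (meson colourable_local_move)

lemma colourable_same_link: "same_link D E \<Longrightarrow> colourable D \<longleftrightarrow> colourable E"
  unfolding same_link_def
  by (induction rule: equivclp_induct) (auto dest: colourable_diagram_move)

lemma not_colourable_unknot: "\<not> colourable [Cap 0, Cup 0]"
proof
  assume "colourable [Cap 0, Cup 0]"
  then obtain x where x: "\<nexists>b. range (\<lambda>_ :: nat. e) \<union> (range (cap 0 x (\<lambda>_. e)) \<union> range (\<lambda>_ :: nat. e)) \<subseteq> {e, b}"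
    unfolding colourable_def by auto
  then show False by (auto simp: range_cap)
qed

lemma not_unknot_if_colourable: "colourable D \<Longrightarrow> \<not> is_unknot D"
  using not_colourable_unknot colourable_same_link unfolding is_unknot_def by blast

lemma colourableI:
  assumes "colours D (\<lambda>_. e) s" "colours E s (\<lambda>_. e)" "s i \<noteq> e" "s j \<noteq> e" "s i \<noteq> s j"
  shows "colourable (D @ E)"
proof -
  from assms(1,2) obtain X Y where XY: "colouring D (\<lambda>_. e) s X" "colouring E s (\<lambda>_. e) Y"
    by (auto simp: colours_def)
  then have "colouring (D @ E) (\<lambda>_. e) (\<lambda>_. e) (X \<union> Y)"
    unfolding colouring_append by blast
  moreover have "s i \<in> X \<union> Y" "s j \<in> X \<union> Y"
    using range_bottom[OF XY(1)] by auto
  then have "\<nexists>b. X \<union> Y \<subseteq> {e, b}"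
    using assms(3-5) by blast
  ultimately show ?thesis unfolding colourable_def by blast
qed

lemma colours_append: "colours (D @ E) u v \<longleftrightarrow> (\<exists>s. colours D u s \<and> colours E s v)"
  by (auto simp: colours_def colouring_append)

end

text \<open>The dihedral kei of integers modulo \<open>m\<close> on the representatives 0 to
  \<open>m - 1\<close>, which gives Fox colourings. All other integers are fixed and act trivially,
  so -1 can serve as base point.\<close>

definition dihedral :: "int \<Rightarrow> int \<Rightarrow> int \<Rightarrow> int" where
  "dihedral m x y = (if x \<in> {0..<m} \<and> y \<in> {0..<m} then (2 * x - y) mod m else y)"

lemma twice_mod_diff_mod: "(2 * (x mod m) - y) mod m = (2 * x - y) mod (m :: int)"
  using mod_diff_cong[of "2 * (x mod m)" m "2 * x" y y] by (simp add: mod_mult_right_eq)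

lemma pointed_kei_dihedral: "pointed_kei (dihedral m) (- 1)"
proof
  fix x y z :: int
  show "dihedral m x x = x" "dihedral m (- 1) x = x" "dihedral m x (- 1) = - 1"
    by (auto simp: dihedral_def)
  show "dihedral m x (dihedral m x y) = y"
    by (auto simp: dihedral_def mod_diff_right_eq)
  show "dihedral m (dihedral m x y) z = dihedral m x (dihedral m y (dihedral m x z))"
    by (auto simp: dihedral_def mod_diff_right_eq) (simp add: twice_mod_diff_mod algebra_simps)
qed

section \<open>Fox colourings of plats\<close>

text \<open>The list holds unreduced integers, so that labels are computed by linear formulas;
  beyond it stands the base point of the dihedral kei.\<close>

definition residues :: "int \<Rightarrow> int list \<Rightarrow> nat \<Rightarrow> int" where
  "residues m xs j = (if j < length xs then (xs ! j) mod m else - 1)"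

context
  fixes m :: int
  assumes m: "m > 1"
begin

interpretation pointed_kei "dihedral m" "- 1"
  by (rule pointed_kei_dihedral)

lemma dihedral_mod [simp]: "dihedral m (x mod m) (y mod m) = (2 * x - y) mod m"
  using m by (simp add: dihedral_def mod_diff_right_eq twice_mod_diff_mod)

lemma cross_0_residues:
  "cross 0 NW_SE (residues m (x # y # zs)) = residues m ((2 * x - y) # x # zs)"
  "cross 0 NE_SW (residues m (x # y # zs)) = residues m (y # (2 * y - x) # zs)"
  by (rule ext; simp add: residues_def nth_Cons split: nat.split)+

lemma cross_1_residues:
  "cross (Suc 0) NW_SE (residues m (w # x # y # zs)) = residues m (w # (2 * x - y) # x # zs)"
  "cross (Suc 0) NE_SW (residues m (w # x # y # zs)) = residues m (w # y # (2 * y - x) # zs)"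
  by (rule ext; simp add: residues_def nth_Cons split: nat.split)+

text \<open>A twist preserves the difference of the two labels and adds this difference, with the
  sign of the twist, to both.\<close>

lemma colours_twists:
  defines "S \<equiv> \<lambda>ws. sum_list (map val ws)"
  shows "colours (map (Cross 0) ws) (residues m (x # y # zs))
    (residues m ((x + S ws * (x - y)) # (y + S ws * (x - y)) # zs))"
proof (induction ws arbitrary: x y)
  case Nil
  show ?case by (simp add: S_def)
next
  case (Cons c ws)
  show ?case
  proof (cases c)
    case NW_SE
    with Cons[of "2 * x - y" x] show ?thesis
      by (simp add: S_def cross_0_residues algebra_simps del: cross.simps)
  next
    case NE_SW
    with Cons[of y "2 * y - x"] show ?thesis
      by (simp add: S_def cross_0_residues algebra_simps del: cross.simps)
  qed
qed

lemma cap_0_residues: "x \<in> {0..<m} \<Longrightarrow> cap 0 x (\<lambda>_. - 1) = residues m [x, x]"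
  by (rule ext) (auto simp: residues_def cap_def nth_Cons split: nat.splits)

lemma cap_1_residues:
  "y \<in> {0..<m} \<Longrightarrow> cap 1 y (residues m (x # zs)) = residues m (x # y # y # zs)"
  by (rule ext) (auto simp: residues_def cap_def nth_Cons split: nat.splits)

lemma cup_residues:
  "cup 0 (residues m [x, y]) = (\<lambda>_. - 1)"
  "cup 1 (residues m (x # y # z # zs)) = residues m (x # zs)"
  by (rule ext; auto simp: residues_def cup_def nth_Cons split: nat.splits)+

lemma colours_caps: "colours [Cap 0, Cap 1] (\<lambda>_. - 1) (residues m [0, 1, 1, 0])"
proof -
  have "residues m [0, 1, 1, 0] = cap 1 1 (cap 0 0 (\<lambda>_. - 1))"
    using m by (simp add: cap_0_residues cap_1_residues[simplified])
  then show ?thesis by auto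
qed

lemma colours_cups:
  assumes "m dvd x - w" "m dvd y - z"
  shows "colours [Cup 1, Cup 0] (residues m [x, y, z, w]) (\<lambda>_. - 1)"
proof -
  have "x mod m = w mod m" "y mod m = z mod m"
    using assms by (simp_all add: mod_eq_dvd_iff)
  then show ?thesis
    by (simp add: cup_residues[simplified]) (simp add: residues_def)
qed

text \<open>The caps get the labels 0 (outer) and 1 (inner), already distinct modulo
  \<open>m\<close>. The two divisibility conditions say that the outer and the inner cup
  close.\<close>

lemma colourable_plat:
  assumes "colours D (residues m [0, 1, 1, 0]) (residues m [x, y, z, w])"
    and "m dvd x + sum_list (map val ws) * (x - y) - w" "m dvd y + sum_list (map val ws) * (x - y) - z"
  shows "colourable (plat D ws)"
  unfolding plat_def
proof (rule colourableI)
  show "colours [Cap 0, Cap 1] (\<lambda>_. - 1) (residues m [0, 1, 1, 0])"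
    by (rule colours_caps)
  show "colours (D @ map (Cross 0) ws @ [Cup 1, Cup 0]) (residues m [0, 1, 1, 0]) (\<lambda>_. - 1)"
    unfolding colours_append using assms colours_twists colours_cups by blast
  show "residues m [0, 1, 1, 0] 0 \<noteq> - 1" "residues m [0, 1, 1, 0] 1 \<noteq> - 1"
      "residues m [0, 1, 1, 0] 0 \<noteq> residues m [0, 1, 1, 0] 1"
    using m by (simp_all add: residues_def)
qed

lemma not_unknot_torus:
  assumes "m dvd sum_list (map val ws)"
  shows "\<not> is_unknot (plat [] ws)"
  by (rule not_unknot_if_colourable, rule colourable_plat[of "[]" 0 1 1 0]) (use assms in simp_all)

lemma not_unknot_clasp:
  assumes "m dvd 3 * sum_list (map val ws) + 2 * val c"
  shows "\<not> is_unknot (plat (clasp c) ws)"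
proof (rule not_unknot_if_colourable, rule colourable_plat)
  let ?s = "sum_list (map val ws)"
  \<comment> \<open>These labels arise by carrying 0, 1, 1, 0 through the three crossings. The first
    two differ by -3, so a word with sum \<open>?s\<close> adds \<open>- 3 * ?s\<close>, and both
    cups close iff \<open>m\<close> divides \<open>3 * ?s + 2 * val c\<close>.\<close>
  show "colours (clasp c) (residues m [0, 1, 1, 0])
      (residues m [- 2 * val c, 3 - 2 * val c, 3, 0])"
    by (cases c) (simp_all add: clasp_def cross_0_residues cross_1_residues del: cross.simps)
  have "m dvd - (3 * ?s + 2 * val c)"
    using assms by (simp only: dvd_minus_iff)
  then show "m dvd - 2 * val c + ?s * (- 2 * val c - (3 - 2 * val c)) - 0"
    "m dvd 3 - 2 * val c + ?s * (- 2 * val c - (3 - 2 * val c)) - 3"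
    by (simp_all add: algebra_simps)
qed

end

lemma dvd_if_abs_neq_1: "\<bar>d\<bar> \<noteq> 1 \<Longrightarrow> \<exists>m > 1. m dvd (d :: int)"
  \<comment> \<open>Determinant 0 admits every modulus; 2 is chosen.\<close>
  by (rule exI[of _ "if d = 0 then 2 else \<bar>d\<bar>"]) auto

lemma is_unknot_torus_iff: "is_unknot (plat [] ws) \<longleftrightarrow> \<bar>sum_list (map val ws)\<bar> = 1"
proof
  assume "is_unknot (plat [] ws)"
  then show "\<bar>sum_list (map val ws)\<bar> = 1"
    using not_unknot_torus dvd_if_abs_neq_1 by blast
next
  assume "\<bar>sum_list (map val ws)\<bar> = 1"
  then have "sum_list (map val ws) = val NW_SE \<or> sum_list (map val ws) = val NE_SW"
    by auto
  then obtain c where "sum_list (map val ws) = val c"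
    by blast
  then have "sum_list (map val ws) = sum_list (map val [c])"
    by simp
  from teq_plat_sum_eq[OF this, of "[]"] show "is_unknot (plat [] ws)"
    using is_unknot_teq is_unknot_plat_1 closed_plat by simp
qed

text \<open>For v = 1 or v = -1, determinant 1 means that 3s is -2v + 1 or -2v - 1. Only -3v among
  these values is a multiple of 3, so s = -v, and that plat is unknotted by
  \<open>teq_clasp\<close>.\<close>

lemma is_unknot_clasp_iff: "is_unknot (plat (clasp c) ws) \<longleftrightarrow> sum_list (map val ws) = - val c"
proof
  assume unknot: "is_unknot (plat (clasp c) ws)"
  have "\<bar>3 * sum_list (map val ws) + 2 * val c\<bar> = 1"
    using unknot not_unknot_clasp dvd_if_abs_neq_1 by blast
  moreover have "s = - v" if "\<bar>3 * s + 2 * v\<bar> = 1" "v = 1 \<or> v = - 1" for s v :: int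
    using that by arith
  ultimately show "sum_list (map val ws) = - val c"
    by (cases c) auto
next
  have closed: "width 4 (clasp c) = Some 4"
    by (simp add: clasp_def)
  assume "sum_list (map val ws) = - val c"
  then have "sum_list (map val ws) = sum_list (map val [other c])"
    by simp
  from teq_plat_sum_eq[OF this closed] show "is_unknot (plat (clasp c) ws)"
    using is_unknot_teq[OF _ closed_plat[OF closed]] is_unknot_teq[OF teq_clasp closed_plat[OF closed]]
      is_unknot_plat_1 by blast
qed

section \<open>The unknot criterion for assignments\<close>

definition row :: "nat \<Rightarrow> (crossing \<Rightarrow> strand) \<Rightarrow> strand list" where
  "row n a = map (\<lambda>k. other (a (Row k))) [1..<n + 1]"

lemma teq_diagram_of:
  assumes "n \<ge> 1"
  shows "teq 0 (diagram_of n a) (plat [Cross 0 (a R), Cross 0 (a L), Cross 1 (a B)] (row n a))"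
proof -
  let ?top = "[Cap 0, Cap 1, Cross 0 (a L), Cross 2 (a R), Cross 1 (a B)]"
  let ?caps = "map (\<lambda>k. Cap (2 * k)) [1..<n] :: diagram"
  let ?crosses = "map (\<lambda>k. Cross (2 * k - 1) (a (Row k))) [1..<n + 1]"
  let ?cups = "replicate (n + 1) (Cup 0) :: diagram"
  have "diagram_of n a = ?top @ (?caps @ ?crosses @ ?cups) @ []"
    by (simp add: diagram_of_def free_21n_def)
  also have "teq 0 \<dots> (?top @ (map (\<lambda>k. Cross 0 (other (a (Row k)))) [1..<n + 1] @ [Cup 1, Cup 0]) @ [])"
  proof (rule teq_context)
    fix v assume "width 0 ?top = Some v"
    then have "v = 4" by simp
    then show "teq v (?caps @ ?crosses @ ?cups)
        (map (\<lambda>k. Cross 0 (other (a (Row k)))) [1..<n + 1] @ [Cup 1, Cup 0])"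
      using teq_row[OF assms, of "\<lambda>k. a (Row k)"] by simp
  qed
  also have "\<dots> = plat [Cross 0 (a L), Cross 2 (a R), Cross 1 (a B)] (row n a)"
    by (simp add: plat_def row_def comp_def)
  also have "teq 0 \<dots> (plat [Cross 0 (a R), Cross 0 (a L), Cross 1 (a B)] ([] @ row n a))"
    by (rule teq_plat_head) (use teq_head in simp)
  finally show ?thesis by simp
qed

lemma is_unknot_diagram_of:
  fixes a :: "crossing \<Rightarrow> strand"
  assumes "n \<ge> 1"
  defines "s \<equiv> sum_list (map val (row n a))"
  shows "is_unknot (diagram_of n a) \<longleftrightarrow>
    (if a L \<noteq> a R then \<bar>s\<bar> = 1
     else if a B = a L then \<bar>s - 2 * val (a L)\<bar> = 1 else s = - val (a L))"
proof -
  let ?head = "[Cross 0 (a R), Cross 0 (a L), Cross 1 (a B)]"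
  have "is_closed (diagram_of n a)"
    using closed_free_21n[OF assms(1)] by (simp add: diagram_of_def closed_map_event)
  then have eq: "is_unknot (diagram_of n a) \<longleftrightarrow> is_unknot (plat ?head (row n a))"
    using is_unknot_teq teq_diagram_of[OF assms(1)] by blast
  have head: "is_unknot (plat ?head (row n a)) \<longleftrightarrow> is_unknot (plat E (us @ row n a))"
    if "teq 0 ([Cap 0, Cap 1] @ ?head) ([Cap 0, Cap 1] @ E @ map (Cross 0) us)" for E us
    by (rule is_unknot_teq[OF teq_plat_head[OF that] closed_plat]) simp
  consider "a R = other (a L)" | "a R = a L" "a B = a L" | "a R = a L" "a B = other (a L)"
    by (cases "a R"; cases "a L"; cases "a B") auto
  then show ?thesis
  proof cases
    case 1
    then have "a L \<noteq> a R" by (cases "a L") auto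
    then show ?thesis
      using head[of "[]" "[]"] 1 teq_cancelling_clasp[of "a L" "a B"]
      by (simp add: eq s_def is_unknot_torus_iff)
  next
    case 2
    then show ?thesis
      \<comment> \<open>The two twists produced by the head join the word of the row and shift its
        sum by \<open>- 2 * val (a L)\<close>.\<close>
      using head[of "[]" "[other (a L), other (a L)]"] teq_coherent_clasp[of "a L"]
      by (simp add: eq s_def is_unknot_torus_iff algebra_simps)
  next
    case 3
    then have "a B \<noteq> a L" by (cases "a L") auto
    with 3 show ?thesis
      using is_unknot_clasp_iff[of "a L" "row n a"] by (simp add: eq s_def clasp_def)
  qed
qed

section \<open>Counting assignments\<close>

lemma UNIV_strand: "(UNIV :: strand set) = {NW_SE, NE_SW}"
  using strand.exhaust by blast

text \<open>Because of the quarter turn, a row crossing decorated \<open>NE_SW\<close> contributes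
  +1 and any other one -1.\<close>

lemma sum_list_row:
  "sum_list (map val (row n a)) = 2 * int (card {k \<in> {1..n}. a (Row k) = NE_SW}) - int n"
proof -
  let ?K = "{k \<in> {1..n}. a (Row k) = NE_SW}"
  have val: "val (other c) = 2 * of_bool (c = NE_SW) - 1" for c
    by (cases c) auto
  have "sum_list (map val (row n a)) = (\<Sum>k = 1..n. val (other (a (Row k))))"
    by (simp add: row_def comp_def interv_sum_list_conv_sum_set_nat atLeastLessThanSuc_atLeastAtMost
        del: val_other upt_Suc)
  also have "\<dots> = 2 * (\<Sum>k = 1..n. of_bool (a (Row k) = NE_SW)) - int n"
    unfolding val by (simp add: sum_subtractf sum_distrib_left)
  also have "(\<Sum>k = 1..n. of_bool (a (Row k) = NE_SW)) = int (card ?K)"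
    by (simp add: of_bool_def sum.If_cases Int_def conj_commute)
  finally show ?thesis .
qed

lemma finite_crossings: "finite (crossings n)"
  by (simp add: crossings_def)

lemma card_crossings: "card (crossings n) = n + 3"
proof -
  have "card (Row ` {1..n}) = n"
    by (simp add: card_image inj_on_def)
  moreover have "crossings n = insert L (insert R (insert B (Row ` {1..n})))"
    by (simp add: crossings_def)
  ultimately show ?thesis by (simp add: card_insert_if image_iff)
qed

lemma card_assignments: "card (assignments n) = 2 ^ (n + 3)"
proof -
  have "card (UNIV :: strand set) = 2" by (simp add: UNIV_strand)
  then show ?thesis
    by (simp add: assignments_def card_PiE finite_crossings card_crossings)
qed

text \<open>The unknot criterion depends only on the three upper crossings and on the size of this
  set, which reduces the count to counting subsets of given sizes.\<close>

definition data :: "nat \<Rightarrow> (crossing \<Rightarrow> strand) \<Rightarrow> (strand \<times> strand \<times> strand) \<times> nat set" where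
  "data n a = ((a L, a R, a B), {k \<in> {1..n}. a (Row k) = NE_SW})"

lemma bij_betw_data: "bij_betw (data n) (assignments n) (UNIV \<times> Pow {1..n})"
proof (rule bij_betwI')
  fix a b assume ab: "a \<in> assignments n" "b \<in> assignments n"
  show "data n a = data n b \<longleftrightarrow> a = b"
  proof
    assume eq: "data n a = data n b"
    have "a x = b x" if "x \<in> crossings n" for x
    proof (cases x)
      case (Row k)
      with that have "k \<in> {1..n}" by (auto simp: crossings_def)
      with eq have "a (Row k) = NE_SW \<longleftrightarrow> b (Row k) = NE_SW"
        by (auto simp: data_def set_eq_iff)
      with Row show ?thesis
        by (cases "a (Row k)"; cases "b (Row k)") auto
    qed (use eq in \<open>auto simp: data_def\<close>)
    with ab show "a = b"
      unfolding assignments_def by (rule PiE_ext)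
  qed simp
next
  fix t :: "(strand \<times> strand \<times> strand) \<times> nat set" assume t: "t \<in> UNIV \<times> Pow {1..n}"
  obtain l r b K where lrbK: "t = ((l, r, b), K)" by (metis surj_pair)
  define a where "a = restrict (\<lambda>x. case x of L \<Rightarrow> l | R \<Rightarrow> r | B \<Rightarrow> b
    | Row k \<Rightarrow> if k \<in> K then NE_SW else NW_SE) (crossings n)"
  have "data n a = t"
    using t by (auto simp: a_def data_def lrbK crossings_def)
  moreover have "a \<in> assignments n"
    by (simp add: a_def assignments_def)
  ultimately show "\<exists>a\<in>assignments n. t = data n a" by blast
qed (auto simp: data_def)

lemma card_subsets_eq_or:
  assumes "i \<noteq> j"
  shows "card {K \<in> Pow {1..n}. card K = i \<or> card K = j} = (n choose i) + (n choose j)"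
proof -
  have "{K \<in> Pow {1..n}. card K = i \<or> card K = j} =
      {K. K \<subseteq> {1..n} \<and> card K = i} \<union> {K. K \<subseteq> {1..n} \<and> card K = j}"
    by auto
  also have "card \<dots> = (n choose i) + (n choose j)"
    by (subst card_Un_disjoint) (use assms in \<open>auto simp: n_subsets\<close>)
  finally show ?thesis .
qed

theorem theorem6p2:
  fixes n :: nat
  assumes "n \<ge> 1" and "odd n"
  shows "card (assignments n) = 2 ^ (n + 3) \<and>
    card {a \<in> assignments n. is_unknot (diagram_of n a)} =
      12 * binom n ((int n - 1) div 2) + 2 * binom n ((int n - 3) div 2)"
proof
  show "card (assignments n) = 2 ^ (n + 3)" by (rule card_assignments)
  obtain h where h: "n = 2 * h + 1" using assms(2) by (elim oddE)
  \<comment> \<open>With c row crossings decorated \<open>NE_SW\<close>, the sum of the row is 2(c -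
    h) - 1; solving the criterion for c gives these values. Writing \<open>c + 1 = h\<close> avoids
    truncated subtraction at \<open>h = 0\<close>.\<close>
  define Q where "Q = (\<lambda>(l, r, b) c.
    if l \<noteq> r then c = h \<or> c = h + 1
    else if b = NW_SE \<and> l = NW_SE then c = h + 1 \<or> c = h + 2
    else if b = NE_SW \<and> l = NE_SW then c = h \<or> c + 1 = h
    else if l = NW_SE then c = h else c = h + 1)"
  have sums: "\<bar>2 * int c - int n\<bar> = 1 \<longleftrightarrow> c = h \<or> c = h + 1"
    "\<bar>2 * int c - int n - 2 * val NW_SE\<bar> = 1 \<longleftrightarrow> c = h + 1 \<or> c = h + 2"
    "\<bar>2 * int c - int n - 2 * val NE_SW\<bar> = 1 \<longleftrightarrow> c = h \<or> c + 1 = h"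
    "2 * int c - int n = - val NW_SE \<longleftrightarrow> c = h"
    "2 * int c - int n = - val NE_SW \<longleftrightarrow> c = h + 1" for c
    unfolding h val.simps by linarith+
  have Q: "is_unknot (diagram_of n a) \<longleftrightarrow> Q (fst (data n a)) (card (snd (data n a)))" for a
  proof -
    define c where "c = card {k \<in> {1..n}. a (Row k) = NE_SW}"
    have "is_unknot (diagram_of n a) \<longleftrightarrow> Q (a L, a R, a B) c"
      unfolding is_unknot_diagram_of[OF assms(1)] sum_list_row c_def[symmetric]
      by (cases "a L"; cases "a R"; cases "a B") (simp_all add: Q_def sums del: val.simps)
    then show ?thesis by (simp add: data_def c_def)
  qed
  have "card {a \<in> assignments n. is_unknot (diagram_of n a)} =
      card {t \<in> UNIV \<times> Pow {1..n}. Q (fst t) (card (snd t))}"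
  proof (rule bij_betw_same_card)
    show "bij_betw (data n) {a \<in> assignments n. is_unknot (diagram_of n a)}
        {t \<in> UNIV \<times> Pow {1..n}. Q (fst t) (card (snd t))}"
      by (rule bij_betw_Collect[OF bij_betw_data]) (simp add: Q)
  qed
  also have "{t \<in> UNIV \<times> Pow {1..n}. Q (fst t) (card (snd t))} =
      (SIGMA u : UNIV. {K \<in> Pow {1..n}. Q u (card K)})"
    by auto
  also have "card \<dots> = (\<Sum>u\<in>UNIV. card {K \<in> Pow {1..n}. Q u (card K)})"
    by (rule card_SigmaI) (auto simp: UNIV_strand simp flip: UNIV_Times_UNIV)
  also have "\<dots> = (\<Sum>l\<in>UNIV. \<Sum>r\<in>UNIV. \<Sum>b\<in>UNIV. card {K \<in> Pow {1..n}. Q (l, r, b) (card K)})"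
    by (simp add: sum.cartesian_product flip: UNIV_Times_UNIV)
  also have "\<dots> = 12 * binom n ((int n - 1) div 2) + 2 * binom n ((int n - 3) div 2)"
  proof -
    have binom_h: "binom n ((int n - 1) div 2) = n choose h"
      by (simp add: binom_def h)
    have sym: "n choose (h + 1) = n choose h"
      using binomial_symmetric[of h n] by (simp add: h)
    have one: "card {K \<in> Pow {1..n}. card K = j} = n choose j" for j
      using n_subsets[of "{1..n}" j] by simp
    have lower: "card {K \<in> Pow {1..n}. card K = h \<or> card K + 1 = h} =
        (n choose h) + binom n ((int n - 3) div 2)"
    \<comment> \<open>For \<open>h = 0\<close> no set has size -1, in agreement with the vanishing
      of \<open>binom\<close> at a negative index.\<close>
    proof (cases h)
      case 0
      then show ?thesis using one[of 0] by (simp add: binom_def h)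
    next
      case (Suc i)
      then have "binom n ((int n - 3) div 2) = n choose i"
        by (simp add: binom_def h)
      then show ?thesis
        using card_subsets_eq_or[of h i n] Suc by simp
    qed
    have upper: "n choose (h + 2) = binom n ((int n - 3) div 2)"
    proof (cases h)
      case 0
      then show ?thesis by (simp add: binom_def h)
    next
      case (Suc i)
      then show ?thesis using binomial_symmetric[of "h + 2" n] by (simp add: binom_def h)
    qed
    \<comment> \<open>By symmetry sizes h and h + 1 are equally frequent, as are h - 1 and h + 2.
      The four cancelling heads contribute 8 times n choose h, the two clasps 2 times, and each of
      the two coherent heads once, together with one term for h - 1.\<close>
    show ?thesis
      using card_subsets_eq_or[of h "h + 1" n] card_subsets_eq_or[of "h + 1" "h + 2" n] one lower upper sym
      by (simp add: UNIV_strand Q_def binom_h)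
  qed
  finally show "card {a \<in> assignments n. is_unknot (diagram_of n a)} =
      12 * binom n ((int n - 1) div 2) + 2 * binom n ((int n - 3) div 2)" .
qed

end
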